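(* Let $\kappa>0$, $D_\kappa=\pi/\sqrt{\kappa}$, and let $(M,d)$ be a complete $\mathrm{CAT}(\kappa)$ space with $\operatorname{diam}(M)<D_\kappa/2$. Let $A$ and $B$ be non-empty closed convex subsets of $M$ with $A\cap B\neq\emptyset$. Let $x_0\in M$ and let $\{x_n\}_{n\ge0}$ be the alternating projection sequence $x_{2n-1}=P_A(x_{2n-2})$, $x_{2n}=P_B(x_{2n-1})$ for $n\in\mathbb{N}=\{1,2,\dots\}$. Then: (i) $\{x_n\}$ $\Delta$-converges to a point $x\in A\cap B$. (ii) If $A$ and $B$ are boundedly regular, then $\{x_n\}$ converges (in the metric $d$) to a point $x\in A\cap B$. (iii) If $A$ and $B$ are boundedly linearly regular, then $\{x_n\}$ converges linearly to a point $x\in A\cap B$.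
   Context: A geodesic joining $x,y$ in a metric space $(M,d)$ is a map $\gamma:[0,1]\to M$ with $\gamma(0)=x$, $\gamma(1)=y$ and $d(\gamma(s),\gamma(t))=d(x,y)|s-t|$ for all $s,t\in[0,1]$. For $\kappa>0$ put $D_\kappa=\pi/\sqrt{\kappa}$, and let $M_\kappa^2$ be the unit 2-sphere with its angular metric multiplied by $1/\sqrt{\kappa}$. $(M,d)$ is a $\mathrm{CAT}(\kappa)$ space if any two points at distance less than $D_\kappa$ are joined by a geodesic and, for every geodesic triangle of perimeter less than $2D_\kappa$, the distance between any two points of the triangle is at most the distance between the corresponding comparison points in the comparison triangle (same side lengths) in $M_\kappa^2$. A subset $C\subseteq M$ is convex if any two points of $C$ can be joined by a geodesic in $M$ and the image of every such geodesic is contained in $C$. $\operatorname{diam}(M)=\sup\{d(x,y):x,y\in M\}$ and $d(x,C)=\inf\{d(x,c):c\in C\}$. If $(M,d)$ is a complete $\mathrm{CAT}(\kappa)$ space with $\operatorname{diam}(M)<D_\kappa/2$ and $C\subseteq M$ is non-empty, closed and convex, then for each $x\in M$ there is a unique point $P_C(x)\in C$ with $d(x,P_C(x))=d(x,C)$; $P_C$ is called the metric projection onto $C$. $\Delta$-convergence: for a sequence $\{y_n\}\subseteq M$ and $y\in M$ put $r(y,\{y_n\})=\limsup_{n\to\infty}d(y,y_n)$ and $r(\{y_n\})=\inf_{y\in M}r(y,\{y_n\})$; the asymptotic center of $\{y_n\}$ is $A(\{y_n\})=\{y\in M: r(y,\{y_n\})=r(\{y_n\})\}$. The sequence $\{y_n\}$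 $\Delta$-converges to $y\in M$ if for every subsequence $\{y_{n_k}\}$ one has $A(\{y_{n_k}\})=\{y\}$. Linear convergence: $\{y_n\}$ converges linearly to $y\in M$ if there exist $K\ge0$ and $\alpha\in[0,1)$ with $d(y_n,y)\le K\alpha^n$ for all $n\in\mathbb{N}$. Regularity: subsets $A,B\subseteq M$ are boundedly regular if for every bounded $S\subseteq M$ and every $\epsilon>0$ there is $\delta>0$ such that every $x\in S$ with $\max\{d(x,A),d(x,B)\}\le\delta$ satisfies $d(x,A\cap B)\le\epsilon$. They are boundedly linearly regular if for every bounded $S\subseteq M$ there is $k>0$ such that $d(x,A\cap B)\le k\max\{d(x,A),d(x,B)\}$ for all $x\in S$. *)

theory Defs
  imports "HOL-Analysis.Analysis"
begin

text \<open>The carrier \<open>M\<close> and the metric \<open>d\<close> are explicit here because the notion is needed both for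
  a type of class \<^class>\<open>metric_space\<close> and for the model sphere, whose metric is not the one
  inherited from \<open>real ^ 3\<close>. Only the values of \<open>\<gamma>\<close> on \<open>[0,1]\<close> matter.\<close>

definition geodesic_in :: "'b set \<Rightarrow> ('b \<Rightarrow> 'b \<Rightarrow> real) \<Rightarrow> (real \<Rightarrow> 'b) \<Rightarrow> 'b \<Rightarrow> 'b \<Rightarrow> bool" where
  "geodesic_in M d \<gamma> x y \<longleftrightarrow>
     \<gamma> ` {0..1} \<subseteq> M \<and> \<gamma> 0 = x \<and> \<gamma> 1 = y \<and>
     (\<forall>s\<in>{0..1}. \<forall>t\<in>{0..1}. d (\<gamma> s) (\<gamma> t) = d x y * \<bar>s - t\<bar>)"

abbreviation geodesic :: "(real \<Rightarrow> 'a::metric_space) \<Rightarrow> 'a \<Rightarrow> 'a \<Rightarrow> bool" where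
  "geodesic \<equiv> geodesic_in UNIV dist"

definition D_bound :: "real \<Rightarrow> real" where
  "D_bound \<kappa> = pi / sqrt \<kappa>"

abbreviation model_space :: "(real ^ 3) set" where
  "model_space \<equiv> sphere 0 1"

definition model_dist :: "real \<Rightarrow> real ^ 3 \<Rightarrow> real ^ 3 \<Rightarrow> real" where
  "model_dist \<kappa> u v = arccos (u \<bullet> v) / sqrt \<kappa>"

text \<open>A geodesic triangle consists of its vertices and of a choice of the three sides
  \<open>\<gamma>\<^sub>1\<close>, \<open>\<gamma>\<^sub>2\<close>, \<open>\<gamma>\<^sub>3\<close>, traversed cyclically.\<close>

definition geodesic_triangle_in ::
    "'b set \<Rightarrow> ('b \<Rightarrow> 'b \<Rightarrow> real) \<Rightarrow> 'b \<Rightarrow> 'b \<Rightarrow> 'b \<Rightarrow>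
     (real \<Rightarrow> 'b) \<Rightarrow> (real \<Rightarrow> 'b) \<Rightarrow> (real \<Rightarrow> 'b) \<Rightarrow> bool" where
  "geodesic_triangle_in M d x y z \<gamma>\<^sub>1 \<gamma>\<^sub>2 \<gamma>\<^sub>3 \<longleftrightarrow>
     geodesic_in M d \<gamma>\<^sub>1 x y \<and> geodesic_in M d \<gamma>\<^sub>2 y z \<and> geodesic_in M d \<gamma>\<^sub>3 z x"

text \<open>Since geodesics are parametrized proportionally to arc length, the comparison point of
  \<open>\<gamma>\<^sub>i(s)\<close> is the point with the same parameter \<open>s\<close> on the corresponding side \<open>\<gamma>\<^sub>i'\<close> of the
  comparison triangle. A comparison triangle of a triangle of perimeter less than \<open>2 D\<^sub>\<kappa>\<close> exists
  and is unique up to isometry; the definition quantifies over all of them.\<close>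

definition CAT :: "real \<Rightarrow> 'a::metric_space itself \<Rightarrow> bool" where
  "CAT \<kappa> _ \<longleftrightarrow>
     (\<forall>x y :: 'a. dist x y < D_bound \<kappa> \<longrightarrow> (\<exists>\<gamma>. geodesic \<gamma> x y)) \<and>
     (\<forall>(x::'a) y z \<gamma>\<^sub>1 \<gamma>\<^sub>2 \<gamma>\<^sub>3 x' y' z' \<gamma>\<^sub>1' \<gamma>\<^sub>2' \<gamma>\<^sub>3'.
        geodesic_triangle_in UNIV dist x y z \<gamma>\<^sub>1 \<gamma>\<^sub>2 \<gamma>\<^sub>3 \<and>
        dist x y + dist y z + dist z x < 2 * D_bound \<kappa> \<and>
        geodesic_triangle_in model_space (model_dist \<kappa>) x' y' z' \<gamma>\<^sub>1' \<gamma>\<^sub>2' \<gamma>\<^sub>3' \<and>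
        model_dist \<kappa> x' y' = dist x y \<and>
        model_dist \<kappa> y' z' = dist y z \<and>
        model_dist \<kappa> z' x' = dist z x \<longrightarrow>
        (\<forall>(\<gamma>, \<gamma>') \<in> {(\<gamma>\<^sub>1, \<gamma>\<^sub>1'), (\<gamma>\<^sub>2, \<gamma>\<^sub>2'), (\<gamma>\<^sub>3, \<gamma>\<^sub>3')}.
         \<forall>(\<eta>, \<eta>') \<in> {(\<gamma>\<^sub>1, \<gamma>\<^sub>1'), (\<gamma>\<^sub>2, \<gamma>\<^sub>2'), (\<gamma>\<^sub>3, \<gamma>\<^sub>3')}.
         \<forall>s\<in>{0..1}. \<forall>t\<in>{0..1}. dist (\<gamma> s) (\<eta> t) \<le> model_dist \<kappa> (\<gamma>' s) (\<eta>' t)))"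

definition geodesically_convex :: "'a::metric_space set \<Rightarrow> bool" where
  "geodesically_convex C \<longleftrightarrow>
     (\<forall>x\<in>C. \<forall>y\<in>C. (\<exists>\<gamma>. geodesic \<gamma> x y) \<and> (\<forall>\<gamma>. geodesic \<gamma> x y \<longrightarrow> \<gamma> ` {0..1} \<subseteq> C))"

definition metric_projection :: "'a::metric_space set \<Rightarrow> 'a \<Rightarrow> 'a" where
  "metric_projection C x = (THE p. p \<in> C \<and> dist x p = infdist x C)"

definition asymp_radius_at :: "'a::metric_space \<Rightarrow> (nat \<Rightarrow> 'a) \<Rightarrow> ereal" where
  "asymp_radius_at y u = limsup (\<lambda>n. ereal (dist y (u n)))"

definition asymp_radius :: "(nat \<Rightarrow> 'a::metric_space) \<Rightarrow> ereal" where
  "asymp_radius u = (INF y. asymp_radius_at y u)"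

definition asymp_center :: "(nat \<Rightarrow> 'a::metric_space) \<Rightarrow> 'a set" where
  "asymp_center u = {y. asymp_radius_at y u = asymp_radius u}"

definition Delta_converges :: "(nat \<Rightarrow> 'a::metric_space) \<Rightarrow> 'a \<Rightarrow> bool" where
  "Delta_converges u y \<longleftrightarrow> (\<forall>k :: nat \<Rightarrow> nat. strict_mono k \<longrightarrow> asymp_center (u \<circ> k) = {y})"

definition converges_linearly :: "(nat \<Rightarrow> 'a::metric_space) \<Rightarrow> 'a \<Rightarrow> bool" where
  "converges_linearly u y \<longleftrightarrow>
     (\<exists>K\<ge>0. \<exists>\<alpha>\<in>{0..<1}. \<forall>n. dist (u n) y \<le> K * \<alpha> ^ n)"

text \<open>The library sets \<^term>\<open>infdist x {} = 0\<close>, so the next two notions are meaningful only when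
  \<open>A \<inter> B\<close> is non-empty.\<close>

definition boundedly_regular :: "'a::metric_space set \<Rightarrow> 'a set \<Rightarrow> bool" where
  "boundedly_regular A B \<longleftrightarrow>
     (\<forall>S. bounded S \<longrightarrow> (\<forall>\<epsilon>>0. \<exists>\<delta>>0. \<forall>x\<in>S.
        max (infdist x A) (infdist x B) \<le> \<delta> \<longrightarrow> infdist x (A \<inter> B) \<le> \<epsilon>))"

definition boundedly_linearly_regular :: "'a::metric_space set \<Rightarrow> 'a set \<Rightarrow> bool" where
  "boundedly_linearly_regular A B \<longleftrightarrow>
     (\<forall>S. bounded S \<longrightarrow> (\<exists>k>0. \<forall>x\<in>S.
        infdist x (A \<inter> B) \<le> k * max (infdist x A) (infdist x B)))"

end

theory Submission
  imports Defs
begin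

text \<open>After rescaling the metric to \<open>D = sqrt \<kappa> * dist\<close>, all distances are at most some
  \<open>R < \<pi> / 2\<close>, where the cosine is positive and decreasing. Comparison with a spherical triangle, in
  the form of the inequality \<open>CAT_cosine_inequality\<close>, says that along a geodesic from \<open>y\<close> to \<open>z\<close> the
  cosine of the distance from a fixed point is at least what it is on the sphere. Two consequences
  carry the proof.

  First, the inequality at the midpoint shows that points which nearly minimize the distance from a
  point, or the asymptotic radius of a sequence, are close to each other. Hence metric projections
  to closed convex sets and asymptotic centers exist and are unique (\<open>unique_minimizer\<close>).

  Second, the inequality near an end point gives the spherical Pythagorean inequality
  \<open>cos (D x y) \<le> cos (D x p) * cos (D p y)\<close> for the projection \<open>p\<close> of \<open>x\<close> to a convex set that contains \<open>y\<close>
  (\<open>projection_cosine\<close>). So the distances of an alternating projection sequence from every point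
  of \<open>A \<inter> B\<close> decrease (the sequence is Fejer monotone), and its steps tend to \<open>0\<close>; therefore the
  distances from \<open>A\<close> and from \<open>B\<close> tend to \<open>0\<close>.

  For \<open>\<Delta>\<close>-convergence, the asymptotic center of every subsequence lies in \<open>A\<close> and in \<open>B\<close>, because
  projecting it to either set does not increase the asymptotic radius. On \<open>A \<inter> B\<close> the
  distances from the sequence converge, so all subsequences have the same asymptotic radius function
  there, and consequently the same center (\<open>Fejer_Delta_converges\<close>).

  Under bounded regularity the distance from \<open>A \<inter> B\<close> tends to \<open>0\<close>, and a Fejer monotone sequence
  with this property is Cauchy. Under bounded linear regularity each step is at least a fixed fraction
  of the distance \<open>d\<close> from \<open>A \<inter> B\<close>, and the Pythagorean inequality shows that \<open>1 / cos d - 1\<close>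
  contracts by a constant factor (\<open>linear_rate\<close>). As this quantity is comparable to \<open>d\<^sup>2\<close>, the
  distances decay geometrically.\<close>

section \<open>Comparison triangles and the cosine inequality\<close>

text \<open>Spherical interpolation: the great circle through \<open>p\<close> in the direction of the unit tangent
  vector \<open>n\<close> pointing to \<open>q\<close>. The formula for \<open>sin \<theta> *\<^sub>R \<gamma> t\<close> avoids a division, and so it also
  covers \<open>p = q\<close>.\<close>

lemma model_geodesic:
  fixes p q :: "real ^ 3"
  assumes "\<kappa> > 0" "norm p = 1" "norm q = 1" and \<theta>: "\<theta> = arccos (p \<bullet> q)" "\<theta> < pi"
  shows "\<exists>\<gamma>. geodesic_in model_space (model_dist \<kappa>) \<gamma> p q \<and>
    (\<forall>t. sin \<theta> *\<^sub>R \<gamma> t = sin ((1 - t) * \<theta>) *\<^sub>R p + sin (t * \<theta>) *\<^sub>R q)"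
proof -
  have pp: "p \<bullet> p = 1" and qq: "q \<bullet> q = 1"
    using assms(2,3) by (simp_all add: dot_square_norm)
  have pq: "\<bar>p \<bullet> q\<bar> \<le> 1"
    using Cauchy_Schwarz_ineq2[of p q] assms(2,3) by simp
  have cos\<theta>: "cos \<theta> = p \<bullet> q" and \<theta>0: "0 \<le> \<theta>"
    using pq \<theta> by (auto simp: cos_arccos_abs arccos_lbound)
  \<comment> \<open>For \<open>p = q\<close> the quotient has the default value \<open>0\<close>, and then \<open>\<gamma>\<close> is constant, as it should be.\<close>
  define n where "n = (1 / sin \<theta>) *\<^sub>R (q - cos \<theta> *\<^sub>R p)"
  define \<gamma> where "\<gamma> t = cos (t * \<theta>) *\<^sub>R p + sin (t * \<theta>) *\<^sub>R n" for t
  have pn: "p \<bullet> n = 0"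
    by (simp add: n_def inner_diff_right pp cos\<theta>)
  have sn: "sin \<theta> *\<^sub>R n = q - cos \<theta> *\<^sub>R p"
  proof (cases "\<theta> = 0")
    case True
    then have "(q - p) \<bullet> (q - p) = 0"
      using cos\<theta> pp qq by (simp add: inner_diff_left inner_diff_right inner_commute)
    then show ?thesis using True by simp
  next
    case False
    then have "sin \<theta> > 0" using \<theta>0 \<theta>(2) by (simp add: sin_gt_zero)
    then show ?thesis by (simp add: n_def)
  qed
  have nn: "\<theta> = 0 \<or> n \<bullet> n = 1"
  proof (cases "\<theta> = 0")
    case False
    then have s: "sin \<theta> > 0" using \<theta>0 \<theta>(2) by (simp add: sin_gt_zero)
    have "(sin \<theta>)\<^sup>2 * (n \<bullet> n) = (q - cos \<theta> *\<^sub>R p) \<bullet> (q - cos \<theta> *\<^sub>R p)"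
      by (simp flip: sn add: power2_eq_square)
    also have "\<dots> = 1 - (cos \<theta>)\<^sup>2"
      by (simp add: inner_diff_left inner_diff_right pp qq cos\<theta> inner_commute power2_eq_square)
    also have "\<dots> = (sin \<theta>)\<^sup>2 * 1" by (simp add: sin_squared_eq)
    finally show ?thesis using s by simp
  qed simp
  have inner: "\<gamma> s \<bullet> \<gamma> t = cos ((s - t) * \<theta>)" for s t
    using nn pn pp
    by (auto simp: \<gamma>_def inner_add_left inner_add_right inner_commute[of n p] cos_diff left_diff_distrib)
  have "norm (\<gamma> t) = 1" for t
    using inner[of t t] by (simp add: norm_eq_1)
  moreover have "\<gamma> 0 = p" by (simp add: \<gamma>_def)
  moreover have "\<gamma> 1 = q" using sn by (simp add: \<gamma>_def)
  moreover have "model_dist \<kappa> (\<gamma> s) (\<gamma> t) = model_dist \<kappa> p q * \<bar>s - t\<bar>"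
    if "s \<in> {0..1}" "t \<in> {0..1}" for s t
  proof -
    have "\<bar>s - t\<bar> * \<theta> \<le> 1 * \<theta>"
      using that \<theta>0 by (intro mult_right_mono) auto
    then have "arccos (cos (\<bar>s - t\<bar> * \<theta>)) = \<bar>s - t\<bar> * \<theta>"
      using \<theta>0 \<theta>(2) by (intro arccos_cos) auto
    moreover have "cos (\<bar>s - t\<bar> * \<theta>) = cos ((s - t) * \<theta>)"
      by (metis abs_mult abs_of_nonneg \<theta>0 cos_abs_real)
    ultimately show ?thesis
      by (simp add: model_dist_def inner flip: \<theta>(1))
  qed
  moreover have "sin \<theta> *\<^sub>R \<gamma> t = sin ((1 - t) * \<theta>) *\<^sub>R p + sin (t * \<theta>) *\<^sub>R q" for t
  proof -
    have "sin \<theta> *\<^sub>R \<gamma> t = (sin \<theta> * cos (t * \<theta>)) *\<^sub>R p + sin (t * \<theta>) *\<^sub>R (sin \<theta> *\<^sub>R n)"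
      by (simp add: \<gamma>_def scaleR_add_right mult.commute)
    then show ?thesis
      by (simp add: sn sin_diff left_diff_distrib algebra_simps)
  qed
  ultimately show ?thesis
    unfolding geodesic_in_def by (intro exI[of _ \<gamma>]) auto
qed

text \<open>Put the side of length \<open>l\<close> on the equator and solve for the third vertex. The spherical law of
  cosines fixes its coordinate \<open>v\<close>, and the triangle inequalities together with the bound on the
  perimeter say exactly that \<open>\<bar>v\<bar> \<le> sin a\<close>, so that the remaining coordinate is real.\<close>

lemma spherical_triangle_exists:
  fixes a b l :: real
  assumes "0 \<le> a" "a \<le> b + l" "b \<le> a + l" "l \<le> a + b" "a + b + l < 2 * pi"
    "0 < l" "l < pi" "a < pi" "b < pi"
  shows "\<exists>x y z :: real ^ 3. norm x = 1 \<and> norm y = 1 \<and> norm z = 1 \<and>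
    x \<bullet> y = cos a \<and> x \<bullet> z = cos b \<and> y \<bullet> z = cos l"
proof -
  have sl: "sin l > 0" using assms by (simp add: sin_gt_zero)
  have sa: "sin a \<ge> 0" using assms by (simp add: sin_ge_zero)
  have b0: "0 \<le> b" using assms by linarith
  have "cos b \<le> cos \<bar>l - a\<bar>"
    using assms by (intro cos_monotone_0_pi_le) auto
  then have 1: "cos b \<le> cos l * cos a + sin l * sin a"
    by (simp add: cos_diff)
  have "cos (l + a) \<le> cos b"
  proof (cases "l + a \<le> pi")
    case True
    then show ?thesis using assms b0 by (intro cos_monotone_0_pi_le) auto
  next
    case False
    \<comment> \<open>Beyond \<open>\<pi>\<close> the cosine is no longer decreasing; reflect and use the bound on the perimeter.\<close>
    have "cos (l + a) = cos (2 * pi - (l + a))" by (simp add: cos_diff)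
    also have "\<dots> \<le> cos b"
      using assms False b0 by (intro cos_monotone_0_pi_le) auto
    finally show ?thesis .
  qed
  then have 2: "cos l * cos a - sin l * sin a \<le> cos b"
    by (simp add: cos_add)
  define v where "v = (cos b - cos l * cos a) / sin l"
  have v: "sin l * v = cos b - cos l * cos a" using sl by (simp add: v_def)
  have "sin l * \<bar>v\<bar> \<le> sin l * sin a"
    using 1 2 v sl by (metis abs_le_iff abs_mult abs_of_pos add.commute diff_le_eq le_diff_eq minus_diff_eq)
  then have "\<bar>v\<bar> \<le> sin a" using sl by simp
  then have v2: "v\<^sup>2 \<le> (sin a)\<^sup>2" by (metis abs_le_square_iff abs_of_nonneg sa)
  define w where "w = sqrt ((sin a)\<^sup>2 - v\<^sup>2)"
  have w2: "w\<^sup>2 = (sin a)\<^sup>2 - v\<^sup>2" using v2 by (simp add: w_def)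
  let ?x = "vector [cos a, v, w] :: real ^ 3"
  let ?y = "vector [1, 0, 0] :: real ^ 3"
  let ?z = "vector [cos l, sin l, 0] :: real ^ 3"
  have "norm ?x = 1" "norm ?y = 1" "norm ?z = 1"
    unfolding norm_eq_1 using w2
    by (simp_all add: inner_vec_def sum_3 vector_3 flip: power2_eq_square)
  moreover have "?x \<bullet> ?y = cos a" "?x \<bullet> ?z = cos b" "?y \<bullet> ?z = cos l"
    using v by (simp_all add: inner_vec_def sum_3 vector_3 algebra_simps)
  ultimately show ?thesis by blast
qed

text \<open>This is all that the proof needs from the comparison axiom. In the comparison triangle the
  point \<open>\<gamma>' t\<close> is an explicit combination of the end points of its side, so its inner product with
  the opposite vertex is the left-hand side divided by \<open>sin l\<close>; comparison of the distances from
  that vertex turns the equality into an inequality because the cosine is decreasing.\<close>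

lemma CAT_cosine_inequality:
  fixes x y z :: "'a::metric_space"
  assumes \<kappa>: "\<kappa> > 0" and CAT: "CAT \<kappa> TYPE('a)"
    and small: "\<And>u v :: 'a. sqrt \<kappa> * dist u v < pi / 2"
    and \<gamma>: "geodesic \<gamma> y z" and t: "t \<in> {0..1}"
    and l: "l = sqrt \<kappa> * dist y z"
  shows "sin ((1 - t) * l) * cos (sqrt \<kappa> * dist x y) + sin (t * l) * cos (sqrt \<kappa> * dist x z)
    \<le> sin l * cos (sqrt \<kappa> * dist x (\<gamma> t))"
proof (cases "l = 0")
  case False
  define c where "c = sqrt \<kappa>"
  have c: "c > 0" using \<kappa> by (simp add: c_def)
  have D: "D_bound \<kappa> = pi / c" by (simp add: D_bound_def c_def)
  have small': "dist u v < pi / 2 / c" for u v :: 'a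
    using small[of u v] c by (simp add: c_def field_simps)
  define a where "a = c * dist x y"
  define b where "b = c * dist x z"
  have l: "l = c * dist y z" using l by (simp add: c_def)
  have tri: "a \<le> b + l" "b \<le> a + l" "l \<le> a + b" "0 \<le> a" "0 \<le> b" "0 < l"
    using c False dist_triangle[of x y z] dist_triangle[of x z y] dist_triangle[of y z x]
    unfolding a_def b_def l
    by (auto simp: dist_commute simp flip: distrib_left intro!: mult_left_mono)
  have lt: "a < pi / 2" "b < pi / 2" "l < pi / 2" "a < pi" "b < pi" "l < pi"
    using small[of x y] small[of x z] small[of y z] pi_gt_zero unfolding a_def b_def l c_def by linarith+
  obtain x' y' z' :: "real ^ 3" where n: "norm x' = 1" "norm y' = 1" "norm z' = 1"
    and in': "x' \<bullet> y' = cos a" "x' \<bullet> z' = cos b" "y' \<bullet> z' = cos l"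
    using spherical_triangle_exists[of a b l] tri lt by auto
  have ac: "arccos (x' \<bullet> y') = a" "arccos (y' \<bullet> z') = l" "arccos (z' \<bullet> x') = b"
    using tri lt by (auto simp: in' inner_commute[of z'] arccos_cos)
  obtain g1 where g1: "geodesic_in model_space (model_dist \<kappa>) g1 x' y'"
    using model_geodesic[OF \<kappa> n(1,2) ac(1)[symmetric]] lt by auto
  obtain g2 where g2: "geodesic_in model_space (model_dist \<kappa>) g2 y' z'"
    and g2t: "\<And>t. sin l *\<^sub>R g2 t = sin ((1 - t) * l) *\<^sub>R y' + sin (t * l) *\<^sub>R z'"
    using model_geodesic[OF \<kappa> n(2,3) ac(2)[symmetric]] lt by auto
  obtain g3 where g3: "geodesic_in model_space (model_dist \<kappa>) g3 z' x'"
    using model_geodesic[OF \<kappa> n(3,1) ac(3)[symmetric]] lt by auto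
  have ex: "\<exists>\<gamma>. geodesic \<gamma> u v" for u v :: 'a
  proof -
    have "pi / 2 / c < pi / c" using c by (intro divide_strict_right_mono) auto
    then have "dist u v < D_bound \<kappa>" using small'[of u v] D by linarith
    then show ?thesis using CAT unfolding CAT_def by blast
  qed
  obtain \<gamma>1 where \<gamma>1: "geodesic \<gamma>1 x y" using ex by blast
  obtain \<gamma>3 where \<gamma>3: "geodesic \<gamma>3 z x" using ex by blast
  have per: "dist x y + dist y z + dist z x < 2 * D_bound \<kappa>"
  proof -
    have "pi / 2 / c = (pi / c) / 2" "pi / c > 0" using c by auto
    then show ?thesis using small'[of x y] small'[of y z] small'[of z x] D by linarith
  qed
  have md: "model_dist \<kappa> x' y' = dist x y" "model_dist \<kappa> y' z' = dist y z" "model_dist \<kappa> z' x' = dist z x"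
    unfolding model_dist_def ac using c by (auto simp: a_def b_def l dist_commute simp flip: c_def)
  have "dist (\<gamma>1 0) (\<gamma> t) \<le> model_dist \<kappa> (g1 0) (g2 t)"
  proof -
    note C = CAT[unfolded CAT_def, THEN conjunct2, THEN spec[of _ x], THEN spec[of _ y],
        THEN spec[of _ z], THEN spec[of _ \<gamma>1], THEN spec[of _ \<gamma>], THEN spec[of _ \<gamma>3],
        THEN spec[of _ x'], THEN spec[of _ y'], THEN spec[of _ z'],
        THEN spec[of _ g1], THEN spec[of _ g2], THEN spec[of _ g3]]
    have "geodesic_triangle_in UNIV dist x y z \<gamma>1 \<gamma> \<gamma>3"
      "geodesic_triangle_in model_space (model_dist \<kappa>) x' y' z' g1 g2 g3"
      using \<gamma> \<gamma>1 \<gamma>3 g1 g2 g3 by (simp_all add: geodesic_triangle_in_def)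
    with mp[OF C] per md t show ?thesis by simp
  qed
  moreover have "\<gamma>1 0 = x" "g1 0 = x'" using \<gamma>1 g1 by (auto simp: geodesic_in_def)
  ultimately have "c * dist x (\<gamma> t) \<le> arccos (x' \<bullet> g2 t)"
    using c by (simp add: model_dist_def field_simps flip: c_def)
  moreover have "norm (g2 t) = 1" using g2 t by (auto simp: geodesic_in_def image_subset_iff)
  then have ab: "\<bar>x' \<bullet> g2 t\<bar> \<le> 1"
    using Cauchy_Schwarz_ineq2[of x' "g2 t"] n by simp
  ultimately have "cos (arccos (x' \<bullet> g2 t)) \<le> cos (c * dist x (\<gamma> t))"
    using c by (intro cos_monotone_0_pi_le) (auto intro: arccos_ubound)
  then have "sin l * (x' \<bullet> g2 t) \<le> sin l * cos (c * dist x (\<gamma> t))"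
    using ab tri lt by (intro mult_left_mono) (auto simp: cos_arccos_abs intro!: sin_ge_zero)
  moreover have "sin l * (x' \<bullet> g2 t) = sin ((1 - t) * l) * cos a + sin (t * l) * cos b"
  proof -
    have "sin l * (x' \<bullet> g2 t) = x' \<bullet> (sin l *\<^sub>R g2 t)" by simp
    also have "\<dots> = sin ((1 - t) * l) * cos a + sin (t * l) * cos b"
      unfolding g2t by (simp add: inner_add_right in')
    finally show ?thesis .
  qed
  ultimately show ?thesis by (simp add: a_def b_def c_def)
qed simp

section \<open>Trigonometric estimates\<close>

lemma cos_diff_le: "cos b - cos a \<le> \<bar>a - b\<bar>" for a b :: real
proof -
  have "cos b - cos a = 2 * sin ((b + a) / 2) * sin ((a - b) / 2)"
    by (rule cos_diff_cos)
  also have "\<dots> \<le> 2 * (\<bar>sin ((b + a) / 2)\<bar> * \<bar>sin ((a - b) / 2)\<bar>)"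
    using abs_ge_self[of "sin ((b + a) / 2) * sin ((a - b) / 2)"] by (simp add: abs_mult)
  also have "\<dots> \<le> 2 * (1 * \<bar>(a - b) / 2\<bar>)"
    by (intro mult_left_mono mult_mono abs_sin_x_le_abs_x) auto
  finally show ?thesis by simp
qed

text \<open>Through \<open>1 - cos t = 2 sin\<^sup>2 (t / 2)\<close> this is the estimate \<open>\<bar>sin (N s)\<bar> \<le> N \<bar>sin s\<bar>\<close>. It
  converts a linear comparison of distances into one of their cosines.\<close>

lemma one_minus_cos_multiple: "1 - cos (real N * t) \<le> (real N)\<^sup>2 * (1 - cos t)"
proof -
  have half: "1 - cos s = 2 * (sin (s / 2))\<^sup>2" for s :: real
    using cos_double_sin[of "s / 2"] by simp
  have sin: "\<bar>sin (real N * s)\<bar> \<le> real N * \<bar>sin s\<bar>" for s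
  proof (induction N)
    case (Suc N)
    have "real (Suc N) * s = real N * s + s"
      by (simp add: distrib_right)
    then have "\<bar>sin (real (Suc N) * s)\<bar> = \<bar>sin (real N * s) * cos s + cos (real N * s) * sin s\<bar>"
      by (simp only: sin_add)
    also have "\<dots> \<le> \<bar>sin (real N * s)\<bar> * \<bar>cos s\<bar> + \<bar>cos (real N * s)\<bar> * \<bar>sin s\<bar>"
      by (metis abs_mult abs_triangle_ineq)
    also have "\<dots> \<le> \<bar>sin (real N * s)\<bar> * 1 + 1 * \<bar>sin s\<bar>"
      by (intro add_mono mult_mono) auto
    finally show ?case using Suc by (simp add: algebra_simps)
  qed simp
  have "(sin (real N * (t / 2)))\<^sup>2 \<le> (real N * \<bar>sin (t / 2)\<bar>)\<^sup>2"
    using power_mono[OF sin[of "t / 2"], of 2] by simp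
  then show ?thesis
    by (simp add: half power_mult_distrib)
qed

text \<open>By the mean value theorem \<open>a cos R \<le> sin a\<close>, and \<open>sin\<^sup>2 a \<le> 2 (1 - cos a)\<close>. The lemma recovers a
  distance from its secant, the quantity that decays geometrically under linear regularity.\<close>

lemma square_le_sec_minus_one:
  fixes a R :: real
  assumes "0 \<le> a" "a \<le> R" "R < pi / 2"
  shows "(a * cos R)\<^sup>2 \<le> 2 * (1 / cos a - 1)"
proof (cases "a = 0")
  case False
  then have "0 < a" using assms by simp
  have c0: "cos a > 0" using assms by (intro cos_gt_zero_pi) auto
  have cR: "cos R > 0" using assms by (intro cos_gt_zero_pi) auto
  obtain z where z: "0 < z" "z < a" "sin a - sin 0 = (a - 0) * cos z"
    using MVT2[OF \<open>0 < a\<close>, of sin cos] by (auto intro: DERIV_sin)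
  have "cos R \<le> cos z" using z assms by (intro cos_monotone_0_pi_le) auto
  then have "a * cos R \<le> sin a" using z \<open>0 < a\<close> by simp
  then have "(a * cos R)\<^sup>2 \<le> (sin a)\<^sup>2"
    using \<open>0 < a\<close> cR by (intro power_mono) auto
  also have "\<dots> = (1 + cos a) * (1 - cos a)"
    by (simp add: sin_squared_eq power2_eq_square algebra_simps)
  also have "\<dots> \<le> 2 * (1 - cos a)" by (intro mult_right_mono) auto
  also have "\<dots> \<le> 2 * ((1 - cos a) / cos a)"
    using c0 by (simp add: le_divide_eq mult_left_le)
  finally show ?thesis using c0 by (simp add: diff_divide_distrib)
qed simp

section \<open>Minimization in small spaces of curvature at most one\<close>

text \<open>The metric is rescaled so that the curvature bound becomes \<open>1\<close>; \<open>D\<close> is a parameter and not a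
  definition so that it carries the type of the space.\<close>

locale small_CAT1 =
  fixes c R :: real and D :: "'a::complete_space \<Rightarrow> 'a \<Rightarrow> real"
  assumes c_pos: "c > 0"
    and D_eq: "D x y = c * dist x y"
    and R_less: "R < pi / 2"
    and D_le: "D x y \<le> R"
    and geodesic_exists: "\<exists>\<gamma>. geodesic \<gamma> (x :: 'a) y"
    and comparison: "\<lbrakk>geodesic \<gamma> y z; t \<in> {0..1}\<rbrakk> \<Longrightarrow>
      sin ((1 - t) * D y z) * cos (D x y) + sin (t * D y z) * cos (D x z)
      \<le> sin (D y z) * cos (D x (\<gamma> t))"
begin

lemma D_nonneg [simp]: "0 \<le> D x y"
  using c_pos by (simp add: D_eq)

lemma D_self [simp]: "D x x = 0"
  by (simp add: D_eq)

lemma D_commute: "D x y = D y x"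
  by (simp add: D_eq dist_commute)

lemma D_triangle: "D x z \<le> D x y + D y z"
  using c_pos dist_triangle[of x z y] by (simp add: D_eq flip: distrib_left)

lemma D_le_iff: "D x y \<le> D u v \<longleftrightarrow> dist x y \<le> dist u v"
  using c_pos by (simp add: D_eq)

lemma R_nonneg: "0 \<le> R"
  using D_le[of undefined undefined] by simp

lemma D_less_pi_half: "D x y < pi / 2"
  using D_le[of x y] R_less by linarith

lemma D_less_pi: "D x y < pi"
  using D_less_pi_half[of x y] D_nonneg[of x y] by linarith

lemma D_pos: "x \<noteq> y \<Longrightarrow> 0 < D x y"
  using c_pos by (simp add: D_eq)

lemma cos_D_pos: "0 < cos (D x y)"
  using D_le[of x y] R_less by (intro cos_gt_zero_pi) (auto intro: less_le_trans[OF _ D_nonneg])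

lemma cos_D_le_iff: "cos (D x y) \<le> cos (D u v) \<longleftrightarrow> dist u v \<le> dist x y"
proof -
  have "cos (D x y) \<le> cos (D u v) \<longleftrightarrow> D u v \<le> D x y"
    using D_le[of x y] D_le[of u v] R_less pi_gt_zero
    by (intro cos_mono_le_eq) (auto simp del: pi_gt_zero)
  then show ?thesis by (simp add: D_le_iff)
qed

text \<open>The spherical analogue of the parallelogram inequality: the cosine inequality at \<open>t = 1/2\<close>,
  after cancelling \<open>sin (D y z / 2)\<close> from \<open>sin (D y z) = 2 sin (D y z / 2) cos (D y z / 2)\<close>.\<close>

lemma midpoint_comparison:
  assumes "geodesic \<gamma> y z"
  shows "cos (D x y) + cos (D x z) \<le> 2 * cos (D y z / 2) * cos (D x (\<gamma> (1/2)))"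
proof (cases "y = z")
  case True
  have "dist (\<gamma> 0) (\<gamma> (1/2)) = 0" "\<gamma> 0 = y"
    using assms True by (auto simp: geodesic_in_def)
  then show ?thesis using True by simp
next
  case False
  let ?h = "D y z / 2"
  have "0 < ?h" "?h < pi" using D_pos[OF False] D_less_pi[of y z] by linarith+
  then have s: "0 < sin ?h" by (rule sin_gt_zero)
  have "sin ?h * (cos (D x y) + cos (D x z)) \<le> sin (2 * ?h) * cos (D x (\<gamma> (1/2)))"
    using comparison[OF assms, of "1/2" x] by (simp add: distrib_left)
  also have "\<dots> = sin ?h * (2 * cos ?h * cos (D x (\<gamma> (1/2))))"
    unfolding sin_double by simp
  finally show ?thesis using s by simp
qed

lemma convex_geodesic:
  assumes "geodesically_convex C" "y \<in> C" "z \<in> C"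
  obtains \<gamma> where "geodesic \<gamma> y z" "\<And>t. t \<in> {0..1} \<Longrightarrow> \<gamma> t \<in> C"
  using assms unfolding geodesically_convex_def image_subset_iff by metis

lemma convex_UNIV: "geodesically_convex (UNIV :: 'a set)"
  using geodesic_exists by (simp add: geodesically_convex_def)

text \<open>The common properties of the functions \<open>D x\<close> and of the asymptotic radius of a sequence: they
  are nonexpansive, stay below a quarter of a great circle, and satisfy the inequality that
  \<open>D x\<close> satisfies at midpoints. Metric projections and asymptotic centers thereby become
  instances of one minimization problem.\<close>

definition strongly_midconvex :: "('a \<Rightarrow> real) \<Rightarrow> bool" where
  "strongly_midconvex F \<longleftrightarrow> (\<forall>y. 0 \<le> F y \<and> F y \<le> R) \<and> (\<forall>y z. F y \<le> F z + D y z) \<and>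
     (\<forall>\<gamma> y z. geodesic \<gamma> y z \<longrightarrow> cos (F y) + cos (F z) \<le> 2 * cos (D y z / 2) * cos (F (\<gamma> (1/2))))"

text \<open>If \<open>F y\<close> and \<open>F z\<close> are both close to a lower bound \<open>r\<close> of \<open>F\<close>, then the left-hand side is close
  to \<open>2 cos r\<close>, which forces \<open>cos (D y z / 2)\<close> to be close to \<open>1\<close>: near-minimizers are close to each
  other.\<close>

lemma cos_gap_at_midpoint:
  assumes F: "strongly_midconvex F" and C: "geodesically_convex C"
    and r: "0 \<le> r" "\<And>y. y \<in> C \<Longrightarrow> r \<le> F y" and yz: "y \<in> C" "z \<in> C"
  shows "cos (F y) + cos (F z) \<le> 2 * cos (D y z / 2) * cos r"
proof -
  obtain \<gamma> where \<gamma>: "geodesic \<gamma> y z" "\<And>t. t \<in> {0..1} \<Longrightarrow> \<gamma> t \<in> C"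
    using convex_geodesic[OF C yz] by blast
  let ?m = "\<gamma> (1/2)"
  have m: "r \<le> F ?m" using \<gamma> r by simp
  have "cos (F y) + cos (F z) \<le> 2 * cos (D y z / 2) * cos (F ?m)"
    using F \<gamma> by (simp add: strongly_midconvex_def)
  also have "\<dots> \<le> 2 * cos (D y z / 2) * cos r"
  proof (rule mult_left_mono)
    have "F ?m \<le> R" using F by (simp add: strongly_midconvex_def)
    then show "cos (F ?m) \<le> cos r"
      using m r R_less pi_gt_zero by (intro cos_monotone_0_pi_le) linarith+
    show "0 \<le> 2 * cos (D y z / 2)"
      using D_less_pi[of y z] D_nonneg[of y z] by (intro mult_nonneg_nonneg cos_ge_zero) linarith+
  qed
  finally show ?thesis .
qed

text \<open>Minimizing sequences are Cauchy because near-minimizers are close to each other; completeness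
  gives a minimizer, and the same estimate gives uniqueness.\<close>

lemma unique_minimizer:
  assumes F: "strongly_midconvex F" and C: "geodesically_convex C" "closed C" "C \<noteq> {}"
  shows "\<exists>!p. p \<in> C \<and> (\<forall>y\<in>C. F p \<le> F y)"
proof -
  define r where "r = (INF y\<in>C. F y)"
  have F0: "0 \<le> F y" "F y \<le> R" for y using F by (auto simp: strongly_midconvex_def)
  have bdd: "bdd_below (F ` C)" using F0 by (intro bdd_belowI2[of _ 0])
  have r_le: "r \<le> F y" if "y \<in> C" for y
    unfolding r_def using bdd that by (rule cINF_lower)
  have r0: "0 \<le> r" unfolding r_def using C F0 by (intro cINF_greatest) auto
  have rR: "r \<le> R" using C r_le F0 by (metis ex_in_conv order_trans)
  have cr: "0 < cos r" using r0 rR R_less by (intro cos_gt_zero_pi) auto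
  have close: "D y z < \<epsilon>" if yz: "y \<in> C" "z \<in> C" and \<epsilon>: "0 < \<epsilon>" "\<epsilon> \<le> pi"
    and "cos (\<epsilon> / 2) * cos r < cos (F y)" "cos (\<epsilon> / 2) * cos r < cos (F z)" for y z \<epsilon>
  proof (rule ccontr)
    assume "\<not> D y z < \<epsilon>"
    then have "cos (D y z / 2) \<le> cos (\<epsilon> / 2)"
      using \<epsilon> D_le[of y z] R_less by (intro cos_monotone_0_pi_le) auto
    then have "2 * cos (D y z / 2) * cos r \<le> 2 * (cos (\<epsilon> / 2) * cos r)"
      using cr by simp
    with cos_gap_at_midpoint[OF F C(1) r0 r_le yz] that show False by simp
  qed
  have small: "cos (\<epsilon> / 2) * cos r < cos r" if "0 < \<epsilon>" "\<epsilon> \<le> pi" for \<epsilon>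
    using that cr cos_monotone_0_pi[of 0 "\<epsilon> / 2"] by simp
  have "\<exists>y\<in>C. F y < r + inverse (real (Suc n))" for n
  proof -
    have "Inf (F ` C) < r + inverse (real (Suc n))" by (simp add: r_def)
    then show ?thesis using C(3) bdd by (subst (asm) cInf_less_iff) auto
  qed
  then obtain Y where Y: "\<And>n. Y n \<in> C" "\<And>n. F (Y n) < r + inverse (real (Suc n))" by metis
  have FY: "(\<lambda>n. F (Y n)) \<longlonglongrightarrow> r"
  proof (rule tendsto_sandwich[of "\<lambda>_. r" _ _ "\<lambda>n. r + inverse (real (Suc n))"])
    show "(\<lambda>n. r + inverse (real (Suc n))) \<longlonglongrightarrow> r"
      using tendsto_add[OF tendsto_const LIMSEQ_inverse_real_of_nat, of r] by simp
  qed (use Y r_le in \<open>auto intro!: always_eventually less_imp_le\<close>)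
  have "Cauchy Y"
  proof (rule metric_CauchyI)
    fix e :: real assume e: "0 < e"
    define \<epsilon> where "\<epsilon> = min pi (c * e)"
    have \<epsilon>: "0 < \<epsilon>" "\<epsilon> \<le> pi" using e c_pos by (auto simp: \<epsilon>_def)
    have "(\<lambda>n. cos (F (Y n))) \<longlonglongrightarrow> cos r" by (intro tendsto_intros FY)
    from order_tendstoD(1)[OF this small[OF \<epsilon>]]
    obtain N where N: "\<And>n. n \<ge> N \<Longrightarrow> cos (\<epsilon> / 2) * cos r < cos (F (Y n))"
      by (auto simp: eventually_sequentially)
    have "dist (Y m) (Y n) < e" if "m \<ge> N" "n \<ge> N" for m n
    proof -
      have "c * dist (Y m) (Y n) < c * e"
        using close[OF Y(1) Y(1) \<epsilon> N[OF that(1)] N[OF that(2)]] by (simp add: D_eq \<epsilon>_def)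
      then show ?thesis using c_pos by simp
    qed
    then show "\<exists>M. \<forall>m\<ge>M. \<forall>n\<ge>M. dist (Y m) (Y n) < e" by blast
  qed
  then obtain p where p: "Y \<longlonglongrightarrow> p" using Cauchy_convergent_iff convergent_def by blast
  have pC: "p \<in> C" using C(2) Y(1) p by (rule closed_sequentially)
  have "F p \<le> r"
  proof (rule LIMSEQ_le_const)
    have "(\<lambda>n. F (Y n) + c * dist p (Y n)) \<longlonglongrightarrow> r + c * dist p p"
      by (intro tendsto_intros FY p)
    then show "(\<lambda>n. F (Y n) + c * dist p (Y n)) \<longlonglongrightarrow> r" by simp
    show "\<exists>N. \<forall>n\<ge>N. F p \<le> F (Y n) + c * dist p (Y n)"
      using F by (auto simp: strongly_midconvex_def D_eq)
  qed
  then have min: "\<forall>y\<in>C. F p \<le> F y" using r_le by force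
  moreover have "q = p" if q: "q \<in> C" "\<forall>y\<in>C. F q \<le> F y" for q
  proof (rule ccontr)
    assume "q \<noteq> p"
    then have D: "0 < D q p" "D q p \<le> pi"
      using D_pos[of q p] D_less_pi[of q p] by auto
    have "F q = r" "F p = r"
      using q(2) pC r_le[OF pC] r_le[OF q(1)] \<open>F p \<le> r\<close> by force+
    then show False
      using close[OF q(1) pC D] small[OF D] by simp
  qed
  ultimately show ?thesis using pC by blast
qed

section \<open>Metric projections\<close>

lemma strongly_midconvex_D: "strongly_midconvex (D x)"
  unfolding strongly_midconvex_def using D_le midpoint_comparison D_triangle[of x]
  by (metis D_commute D_nonneg)

lemma metric_projection:
  fixes x :: 'a
  assumes "geodesically_convex C" "closed C" "C \<noteq> {}"
  shows "metric_projection C x \<in> C" "dist x (metric_projection C x) = infdist x C"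
proof -
  have "p \<in> C \<and> dist x p = infdist x C \<longleftrightarrow> p \<in> C \<and> (\<forall>y\<in>C. D x p \<le> D x y)" for p
  proof safe
    assume "p \<in> C" "\<forall>y\<in>C. D x p \<le> D x y"
    then show "dist x p = infdist x C"
      unfolding D_le_iff using infdist_notempty[OF assms(3)]
      by (intro antisym infdist_le) (auto intro!: cINF_greatest)
  next
    fix y assume "dist x p = infdist x C" "y \<in> C"
    then show "D x p \<le> D x y" by (simp add: D_le_iff infdist_le)
  qed
  then have "\<exists>!p. p \<in> C \<and> dist x p = infdist x C"
    using unique_minimizer[OF strongly_midconvex_D assms, of x] by simp
  from theI'[OF this]
  show "metric_projection C x \<in> C" "dist x (metric_projection C x) = infdist x C"
    by (auto simp: metric_projection_def)
qed

text \<open>The angle at the foot \<open>p\<close> of the perpendicular is at least a right angle, so the spherical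
  Pythagorean theorem holds as an inequality. Without speaking of angles: no point \<open>\<gamma> t\<close> on the
  geodesic from \<open>p\<close> to \<open>y\<close> is closer to \<open>x\<close> than \<open>p\<close>, and the claim is the derivative at \<open>t = 0\<close> of
  what the cosine inequality then says.\<close>

lemma projection_cosine:
  fixes x :: 'a
  assumes C: "geodesically_convex C" and p: "p \<in> C" "dist x p = infdist x C" and y: "y \<in> C"
  shows "cos (D x y) \<le> cos (D x p) * cos (D p y)"
proof (cases "p = y")
  case False
  define l where "l = D p y"
  have l: "0 < l" "l < pi" using D_pos[OF False] D_less_pi[of p y] by (auto simp: l_def)
  obtain \<gamma> where \<gamma>: "geodesic \<gamma> p y" "\<And>t. t \<in> {0..1} \<Longrightarrow> \<gamma> t \<in> C"
    using convex_geodesic[OF C p(1) y] by blast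
  have ineq: "cos (D x y) * sin (t * l) \<le> cos (D x p) * (sin l - sin ((1 - t) * l))"
    if "t \<in> {0..1}" for t
  proof -
    have "cos (D x (\<gamma> t)) \<le> cos (D x p)"
      unfolding cos_D_le_iff using p(2) \<gamma>(2)[OF that] by (simp add: infdist_le)
    then have "sin l * cos (D x (\<gamma> t)) \<le> sin l * cos (D x p)"
      using l by (intro mult_left_mono sin_ge_zero) auto
    with comparison[OF \<gamma>(1) that, of x] show ?thesis
      by (simp add: l_def algebra_simps)
  qed
  have "((\<lambda>t. sin (t * l)) has_real_derivative l) (at 0)"
    by (auto intro!: derivative_eq_intros)
  then have lim1: "((\<lambda>t. sin (t * l) / t) \<longlongrightarrow> l) (at_right 0)"
    by (auto simp: has_field_derivative_iff intro: tendsto_mono[OF at_le])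
  have "((\<lambda>t. - sin ((1 - t) * l)) has_real_derivative cos l * l) (at 0)"
    by (auto intro!: derivative_eq_intros)
  then have lim2: "((\<lambda>t. (sin l - sin ((1 - t) * l)) / t) \<longlongrightarrow> cos l * l) (at_right 0)"
    by (auto simp: has_field_derivative_iff intro: tendsto_mono[OF at_le])
  have "cos (D x y) * l \<le> cos (D x p) * (cos l * l)"
  proof (rule tendsto_le)
    show "((\<lambda>t. cos (D x y) * (sin (t * l) / t)) \<longlongrightarrow> cos (D x y) * l) (at_right 0)"
      by (intro tendsto_intros lim1)
    show "((\<lambda>t. cos (D x p) * ((sin l - sin ((1 - t) * l)) / t)) \<longlongrightarrow> cos (D x p) * (cos l * l)) (at_right 0)"
      by (intro tendsto_intros lim2)
    have "eventually (\<lambda>t::real. t \<in> {0<..<1}) (at_right 0)"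
      by (rule eventually_at_right_real) simp
    then show "eventually (\<lambda>t. cos (D x y) * (sin (t * l) / t)
        \<le> cos (D x p) * ((sin l - sin ((1 - t) * l)) / t)) (at_right 0)"
    proof eventually_elim
      case (elim t)
      then show ?case using ineq[of t] by (simp add: divide_right_mono)
    qed
  qed simp
  then show ?thesis using l by (simp add: l_def)
qed simp

lemma projection_dist_le:
  fixes x :: 'a
  assumes "geodesically_convex C" "p \<in> C" "dist x p = infdist x C" "y \<in> C"
  shows "dist p y \<le> dist x y"
proof -
  have "cos (D x y) \<le> cos (D x p) * cos (D p y)" by (rule projection_cosine[OF assms])
  also have "\<dots> \<le> 1 * cos (D p y)"
    using cos_D_pos[of p y] by (intro mult_right_mono) auto
  finally show ?thesis by (simp add: cos_D_le_iff)
qed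

section \<open>Asymptotic centers\<close>

definition radius :: "(nat \<Rightarrow> 'a) \<Rightarrow> 'a \<Rightarrow> real" where
  "radius u y = real_of_ereal (asymp_radius_at y u)"

lemma dist_bound: "dist (x::'a) y \<le> R / c"
  using D_le[of x y] c_pos by (simp add: D_eq field_simps)

lemma bounded_space: "bounded (UNIV :: 'a set)"
  unfolding bounded_def using dist_bound by blast

lemma ereal_radius: "ereal (radius u y) = asymp_radius_at y u"
proof -
  have "asymp_radius_at y u \<le> ereal (R / c)"
    unfolding asymp_radius_at_def by (intro Limsup_bounded always_eventually) (simp add: dist_bound)
  moreover have "0 \<le> asymp_radius_at y u"
    unfolding asymp_radius_at_def by (intro le_Limsup always_eventually) auto
  ultimately show ?thesis
    unfolding radius_def by (cases "asymp_radius_at y u") auto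
qed

lemma radius_bounds: "0 \<le> radius u y" "c * radius u y \<le> R"
proof -
  have "0 \<le> ereal (radius u y)"
    unfolding ereal_radius asymp_radius_at_def by (intro le_Limsup always_eventually) auto
  then show "0 \<le> radius u y" by simp
  have "ereal (radius u y) \<le> ereal (R / c)"
    unfolding ereal_radius asymp_radius_at_def
    by (intro Limsup_bounded always_eventually) (simp add: dist_bound)
  then show "c * radius u y \<le> R" using c_pos by (simp add: field_simps)
qed

lemma radius_eventually_less:
  assumes "0 < \<epsilon>"
  shows "eventually (\<lambda>n. dist y (u n) < radius u y + \<epsilon>) sequentially"
proof -
  have "asymp_radius_at y u < ereal (radius u y + \<epsilon>)"
    using assms by (simp flip: ereal_radius)
  from Limsup_lessD[OF this[unfolded asymp_radius_at_def]] show ?thesis by simp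
qed

lemma radius_leI:
  assumes "\<And>\<epsilon>. 0 < \<epsilon> \<Longrightarrow> eventually (\<lambda>n. dist y (u n) \<le> r + \<epsilon>) sequentially"
  shows "radius u y \<le> r"
proof (rule field_le_epsilon)
  fix \<epsilon> :: real assume "0 < \<epsilon>"
  then have "ereal (radius u y) \<le> ereal (r + \<epsilon>)"
    unfolding ereal_radius asymp_radius_at_def by (intro Limsup_bounded) (simp add: assms)
  then show "radius u y \<le> r + \<epsilon>" by simp
qed

lemma radius_le_add:
  assumes e: "e \<longlonglongrightarrow> 0" and le: "\<And>n. dist p (u n) \<le> dist a (u n) + b + e n"
  shows "radius u p \<le> radius u a + b"
proof (rule radius_leI)
  fix \<epsilon> :: real assume "0 < \<epsilon>"
  then have h: "0 < \<epsilon> / 2" by simp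
  show "eventually (\<lambda>n. dist p (u n) \<le> radius u a + b + \<epsilon>) sequentially"
    using radius_eventually_less[OF h, of a u] order_tendstoD(2)[OF e h]
  proof eventually_elim
    case (elim n)
    then show ?case using le[of n] by linarith
  qed
qed

lemma radius_limit:
  assumes "(\<lambda>n. dist y (u n)) \<longlonglongrightarrow> L"
  shows "radius u y = L"
proof -
  have "asymp_radius_at y u = ereal L"
    unfolding asymp_radius_at_def using assms by (intro lim_imp_Limsup) auto
  then show ?thesis by (simp add: radius_def)
qed

text \<open>The midpoint inequality passes to the upper limit. Along a subsequence the distances from the
  midpoint converge to their upper limit, whereas the distances from \<open>y\<close> and \<open>z\<close> are eventually below
  their upper limits up to an error, along every subsequence.\<close>

lemma strongly_midconvex_radius: "strongly_midconvex (\<lambda>y. c * radius u y)"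
  unfolding strongly_midconvex_def
proof (intro conjI allI impI)
  fix y z :: 'a
  show "0 \<le> c * radius u y" using radius_bounds c_pos by simp
  show "c * radius u y \<le> R" by (rule radius_bounds)
  have "radius u y \<le> radius u z + dist y z"
    by (rule radius_le_add[OF tendsto_const]) (metis add.commute add.right_neutral dist_triangle)
  then have "c * radius u y \<le> c * (radius u z + dist y z)"
    using c_pos by simp
  then show "c * radius u y \<le> c * radius u z + D y z"
    by (simp add: D_eq distrib_left)
next
  fix \<gamma> and y z :: 'a assume \<gamma>: "geodesic \<gamma> y z"
  let ?m = "\<gamma> (1/2)" and ?k = "2 * cos (D y z / 2)"
  obtain r where r: "strict_mono r"
    and "((\<lambda>n. ereal (dist ?m (u n))) \<circ> r) \<longlonglongrightarrow> asymp_radius_at ?m u"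
    unfolding asymp_radius_at_def using limsup_subseq_lim by blast
  then have lim: "(\<lambda>n. dist ?m (u (r n))) \<longlonglongrightarrow> radius u ?m"
    by (simp add: comp_def flip: ereal_radius)
  have cos_ev: "eventually (\<lambda>n. cos (c * radius u v) - \<epsilon> \<le> cos (D v (u n))) sequentially"
    if "0 < \<epsilon>" for v \<epsilon>
  proof -
    have "0 < \<epsilon> / c" using that c_pos by simp
    from radius_eventually_less[OF this, of v u] show ?thesis
    proof eventually_elim
      case (elim n)
      then have less: "D v (u n) < c * radius u v + \<epsilon>"
        using c_pos by (simp add: D_eq field_simps)
      show ?case
      proof (cases "D v (u n) \<le> c * radius u v")
        case True
        then have "cos (c * radius u v) \<le> cos (D v (u n))"
          using radius_bounds(2)[of u v] R_less pi_gt_zero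
          by (intro cos_monotone_0_pi_le) (auto simp del: pi_gt_zero)
        then show ?thesis using that by simp
      next
        case False
        then show ?thesis
          using less cos_diff_le[of "c * radius u v" "D v (u n)"] by linarith
      qed
    qed
  qed
  show "cos (c * radius u y) + cos (c * radius u z) \<le> ?k * cos (c * radius u ?m)"
  proof (rule field_le_epsilon)
    fix \<epsilon> :: real assume "0 < \<epsilon>"
    then have h: "0 < \<epsilon> / 2" by simp
    have "cos (c * radius u y) + cos (c * radius u z) - \<epsilon> \<le> ?k * cos (c * radius u ?m)"
    proof (rule tendsto_le[OF trivial_limit_sequentially])
      show "(\<lambda>n. ?k * cos (D ?m (u (r n)))) \<longlonglongrightarrow> ?k * cos (c * radius u ?m)"
        unfolding D_eq by (intro tendsto_intros lim)
      show "eventually (\<lambda>n. cos (c * radius u y) + cos (c * radius u z) - \<epsilon>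
          \<le> ?k * cos (D ?m (u (r n)))) sequentially"
        using eventually_subseq[OF r cos_ev[OF h, of y]] eventually_subseq[OF r cos_ev[OF h, of z]]
      proof eventually_elim
        case (elim n)
        then show ?case
          using midpoint_comparison[OF \<gamma>, of "u (r n)"] by (simp add: D_commute)
      qed
    qed (rule tendsto_const)
    then show "cos (c * radius u y) + cos (c * radius u z) \<le> ?k * cos (c * radius u ?m) + \<epsilon>"
      by simp
  qed
qed

lemma mem_asymp_center_iff:
  fixes u :: "nat \<Rightarrow> 'a"
  shows "a \<in> asymp_center u \<longleftrightarrow> (\<forall>y. radius u a \<le> radius u y)"
proof -
  have "a \<in> asymp_center u \<longleftrightarrow> (\<forall>y. asymp_radius_at a u \<le> asymp_radius_at y u)"
    unfolding asymp_center_def asymp_radius_def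
    by (auto intro!: INF_lower2[OF UNIV_I order_refl] antisym INF_greatest)
  then show ?thesis by (simp flip: ereal_radius)
qed

lemma asymp_center_singleton:
  fixes u :: "nat \<Rightarrow> 'a"
  shows "\<exists>a. asymp_center u = {a}"
proof -
  have "\<exists>!a. a \<in> asymp_center u"
    using unique_minimizer[OF strongly_midconvex_radius convex_UNIV, of u] c_pos
    by (simp add: mem_asymp_center_iff)
  then show ?thesis by auto
qed

text \<open>The projections of the points \<open>u n\<close> to \<open>C\<close> lie asymptotically at the points \<open>u n\<close> themselves, and
  projecting \<open>a\<close> to \<open>C\<close> does not increase its distance from any point of \<open>C\<close>. So the projection of \<open>a\<close> has an
  asymptotic radius that is not larger, and by uniqueness of the center it is \<open>a\<close>.\<close>

lemma asymp_center_in_convex: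
  fixes u :: "nat \<Rightarrow> 'a"
  assumes C: "geodesically_convex C" "closed C" "C \<noteq> {}"
    and lim: "(\<lambda>n. infdist (u n) C) \<longlonglongrightarrow> 0" and a: "a \<in> asymp_center u"
  shows "a \<in> C"
proof -
  note proj = metric_projection[OF C]
  let ?P = "metric_projection C"
  have "radius u (?P a) \<le> radius u a + 0"
  proof (rule radius_le_add)
    show "(\<lambda>n. 2 * infdist (u n) C) \<longlonglongrightarrow> 0"
      using tendsto_mult_right_zero[OF lim, of 2] by simp
    show "dist (?P a) (u n) \<le> dist a (u n) + 0 + 2 * infdist (u n) C" for n
    proof -
      have "dist (?P a) (?P (u n)) \<le> dist a (?P (u n))"
        using projection_dist_le[OF C(1) proj(1) proj(2) proj(1)] .
      moreover have "dist (?P a) (u n) \<le> dist (?P a) (?P (u n)) + dist (u n) (?P (u n))"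
        by (metis dist_commute dist_triangle)
      moreover have "dist a (?P (u n)) \<le> dist a (u n) + dist (u n) (?P (u n))"
        by (rule dist_triangle)
      ultimately show ?thesis by (simp add: proj(2))
    qed
  qed
  then have "?P a \<in> asymp_center u"
    using a unfolding mem_asymp_center_iff by (smt (verit))
  with a asymp_center_singleton[of u] have "?P a = a" by auto
  then show ?thesis using proj(1)[of a] by simp
qed

section \<open>Fejer monotone sequences\<close>

text \<open>For \<open>y \<in> F\<close> the distances from \<open>y\<close> converge, so the asymptotic radius at \<open>y\<close> is the same for all
  subsequences. The centers of the sequence and of a subsequence both lie in \<open>F\<close> and hence minimize
  the same function on \<open>F\<close>; so both are centers of the subsequence, and they coincide.\<close>

lemma Fejer_Delta_converges:
  fixes x :: "nat \<Rightarrow> 'a"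
  assumes F: "F \<noteq> {}" and Fejer: "\<And>y n. y \<in> F \<Longrightarrow> dist y (x (Suc n)) \<le> dist y (x n)"
    and centers: "\<And>k a. strict_mono k \<Longrightarrow> a \<in> asymp_center (x \<circ> k) \<Longrightarrow> a \<in> F"
  shows "\<exists>l\<in>F. Delta_converges x l"
proof -
  have radius_subseq: "radius (x \<circ> k) y = radius x y" if "y \<in> F" "strict_mono k" for y k
  proof -
    have "decseq (\<lambda>n. dist y (x n))" using Fejer[OF that(1)] by (intro decseq_SucI)
    then obtain L where L: "(\<lambda>n. dist y (x n)) \<longlonglongrightarrow> L"
      using decseq_convergent[of "\<lambda>n. dist y (x n)" 0] zero_le_dist by blast
    have "(\<lambda>n. dist y ((x \<circ> k) n)) \<longlonglongrightarrow> L"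
      using LIMSEQ_subseq_LIMSEQ[OF L that(2)] by (simp add: comp_def)
    with L show ?thesis by (simp add: radius_limit)
  qed
  obtain l where l: "asymp_center x = {l}" using asymp_center_singleton by blast
  have lF: "l \<in> F" using centers[of id l] l by (simp add: strict_mono_id)
  have "asymp_center (x \<circ> k) = {l}" if k: "strict_mono k" for k
  proof -
    obtain a where a: "asymp_center (x \<circ> k) = {a}" using asymp_center_singleton by blast
    have aF: "a \<in> F" using centers[OF k, of a] a by simp
    have "radius x l \<le> radius x a" using l mem_asymp_center_iff[of l x] by simp
    then have "radius (x \<circ> k) l \<le> radius (x \<circ> k) a" using radius_subseq aF lF k by simp
    moreover have "\<forall>y. radius (x \<circ> k) a \<le> radius (x \<circ> k) y"
      using a mem_asymp_center_iff[of a "x \<circ> k"] by simp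
    ultimately have "l \<in> asymp_center (x \<circ> k)"
      unfolding mem_asymp_center_iff using order_trans by blast
    then show ?thesis using a by simp
  qed
  then show ?thesis using lF by (auto simp: Delta_converges_def)
qed

text \<open>From time \<open>n\<close> on the sequence stays in the ball around the projection of \<open>x n\<close> to \<open>F\<close> whose radius
  is the distance of \<open>x n\<close> from \<open>F\<close>. This makes the sequence Cauchy and bounds its distance from the
  limit.\<close>

lemma Fejer_converges:
  fixes x :: "nat \<Rightarrow> 'a"
  assumes F: "geodesically_convex F" "closed F" "F \<noteq> {}"
    and Fejer: "\<And>y n. y \<in> F \<Longrightarrow> dist y (x (Suc n)) \<le> dist y (x n)"
    and lim: "(\<lambda>n. infdist (x n) F) \<longlonglongrightarrow> 0"
  shows "\<exists>l\<in>F. x \<longlonglongrightarrow> l \<and> (\<forall>n. dist (x n) l \<le> 2 * infdist (x n) F)"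
proof -
  have close: "dist (x n) (x m) \<le> 2 * infdist (x n) F" if "n \<le> m" for n m
  proof -
    let ?p = "metric_projection F (x n)"
    have p: "?p \<in> F" "dist (x n) ?p = infdist (x n) F" using metric_projection[OF F] by auto
    have "dist ?p (x m) \<le> dist ?p (x n)"
      using lift_Suc_antimono_le[of "\<lambda>n. dist ?p (x n)", OF Fejer[OF p(1)] that] .
    then show ?thesis
      using p(2) dist_triangle[of "x n" "x m" ?p] by (simp add: dist_commute)
  qed
  have "Cauchy x"
  proof (rule metric_CauchyI)
    fix e :: real assume "0 < e"
    then have "eventually (\<lambda>n. infdist (x n) F < e / 4) sequentially"
      by (intro order_tendstoD(2)[OF lim]) simp
    then obtain N where N: "infdist (x N) F < e / 4" by (auto simp: eventually_sequentially)
    have "dist (x m) (x n) < e" if "N \<le> m" "N \<le> n" for m n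
      using close[OF that(1)] close[OF that(2)] N dist_triangle2[of "x m" "x n" "x N"]
      by (simp add: dist_commute)
    then show "\<exists>M. \<forall>m\<ge>M. \<forall>n\<ge>M. dist (x m) (x n) < e" by blast
  qed
  then obtain l where l: "x \<longlonglongrightarrow> l" using Cauchy_convergent_iff convergent_def by blast
  have "(\<lambda>n. infdist (x n) F) \<longlonglongrightarrow> infdist l F" using l by (rule tendsto_infdist)
  then have "infdist l F = 0" using lim LIMSEQ_unique by blast
  then have "l \<in> F" using F by (simp add: in_closed_iff_infdist_zero)
  moreover have "dist (x n) l \<le> 2 * infdist (x n) F" for n
  proof (rule LIMSEQ_le_const2)
    show "(\<lambda>m. dist (x n) (x m)) \<longlonglongrightarrow> dist (x n) l" by (intro tendsto_intros l)
    show "\<exists>N. \<forall>m\<ge>N. dist (x n) (x m) \<le> 2 * infdist (x n) F" using close by blast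
  qed
  ultimately show ?thesis using l by blast
qed

end

section \<open>Alternating projections\<close>

locale alternating_projections = small_CAT1 c R D
  for c R :: real and D :: "'a::complete_space \<Rightarrow> 'a \<Rightarrow> real" +
  fixes A B :: "'a set" and x :: "nat \<Rightarrow> 'a"
  assumes A: "geodesically_convex A" "closed A" and B: "geodesically_convex B" "closed B"
    and AB: "A \<inter> B \<noteq> {}"
    and step: "x (Suc n) = metric_projection (if even n then A else B) (x n)"
begin

lemma convex_Int: "geodesically_convex (A \<inter> B)"
  using A B unfolding geodesically_convex_def by blast

lemma closed_AB: "closed (A \<inter> B)"
  using A B by blast

lemma step_props:
  assumes "C = (if even n then A else B)"
  shows "geodesically_convex C" "x (Suc n) \<in> C" "dist (x n) (x (Suc n)) = infdist (x n) C"
proof -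
  have C: "geodesically_convex C" "closed C" "C \<noteq> {}" using A B AB assms by auto
  show "geodesically_convex C" "x (Suc n) \<in> C" "dist (x n) (x (Suc n)) = infdist (x n) C"
    using metric_projection[OF C, of "x n"] C(1) by (simp_all add: step assms)
qed

lemma step_cosine:
  assumes "y \<in> A \<inter> B"
  shows "cos (D (x n) y) \<le> cos (D (x n) (x (Suc n))) * cos (D (x (Suc n)) y)"
  using projection_cosine[OF step_props[OF refl], of y n] assms by auto

lemma Fejer:
  assumes "y \<in> A \<inter> B"
  shows "dist y (x (Suc n)) \<le> dist y (x n)"
  using projection_dist_le[OF step_props[OF refl], of y n] assms by (auto simp: dist_commute)

text \<open>From the first step on, \<open>x n\<close> lies in one of the two sets, and the next step is the distance
  from the other one.\<close>

lemma max_infdist_le_step: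
  assumes "1 \<le> n"
  shows "max (infdist (x n) A) (infdist (x n) B) \<le> dist (x n) (x (Suc n))"
proof -
  obtain m where m: "n = Suc m" using assms by (cases n) auto
  show ?thesis
    using step_props(2,3)[OF refl, of n] step_props(2)[OF refl, of m]
    by (auto simp: m infdist_nonneg split: if_splits)
qed

text \<open>For \<open>y \<in> A \<inter> B\<close> the distances \<open>D (x n) y\<close> decrease to a limit below \<open>\<pi> / 2\<close>. The Pythagorean
  inequality bounds the cosine of the step from below by a quotient of two cosines that have the
  same positive limit, so it tends to \<open>1\<close>.\<close>

lemma step_tendsto_0: "(\<lambda>n. dist (x n) (x (Suc n))) \<longlonglongrightarrow> 0"
proof -
  obtain y where y: "y \<in> A \<inter> B" using AB by blast
  have "decseq (\<lambda>n. dist y (x n))" using Fejer[OF y] by (intro decseq_SucI)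
  then obtain L where L: "(\<lambda>n. dist y (x n)) \<longlonglongrightarrow> L" "0 \<le> L"
    using decseq_convergent[of "\<lambda>n. dist y (x n)" 0] zero_le_dist
    by (metis LIMSEQ_le_const)
  have DL: "(\<lambda>n. D (x n) y) \<longlonglongrightarrow> c * L"
    unfolding D_eq by (subst dist_commute) (intro tendsto_intros L)
  have "c * L \<le> R" using DL D_le by (intro LIMSEQ_le_const2[OF DL]) auto
  then have cL: "0 < cos (c * L)"
    using L(2) c_pos R_less pi_gt_zero by (intro cos_gt_zero_pi) (auto simp del: pi_gt_zero intro: less_le_trans[of _ 0])
  have 1: "(\<lambda>n. cos (D (x n) (x (Suc n)))) \<longlonglongrightarrow> 1"
  proof (rule tendsto_sandwich)
    have "(\<lambda>n. cos (D (x n) y) / cos (D (x (Suc n)) y)) \<longlonglongrightarrow> cos (c * L) / cos (c * L)"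
      using cL by (intro tendsto_intros DL LIMSEQ_Suc[OF DL]) auto
    then show "(\<lambda>n. cos (D (x n) y) / cos (D (x (Suc n)) y)) \<longlonglongrightarrow> 1" using cL by simp
    show "eventually (\<lambda>n. cos (D (x n) y) / cos (D (x (Suc n)) y) \<le> cos (D (x n) (x (Suc n)))) sequentially"
      using step_cosine[OF y] cos_D_pos by (intro always_eventually) (simp add: divide_le_eq)
    show "(\<lambda>n. 1) \<longlonglongrightarrow> (1::real)" by simp
  qed auto
  have "(\<lambda>n. arccos (cos (D (x n) (x (Suc n))))) \<longlonglongrightarrow> arccos 1"
    by (rule continuous_on_tendsto_compose[OF continuous_on_arccos' 1]) auto
  moreover have "arccos (cos (D (x n) (x (Suc n)))) = D (x n) (x (Suc n))" for n
    using D_less_pi[of "x n" "x (Suc n)"] by (intro arccos_cos) auto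
  ultimately have "(\<lambda>n. D (x n) (x (Suc n)) / c) \<longlonglongrightarrow> 0 / c"
    using c_pos by (intro tendsto_intros) auto
  then show ?thesis using c_pos by (simp add: D_eq)
qed

lemma max_infdist_tendsto_0: "(\<lambda>n. max (infdist (x n) A) (infdist (x n) B)) \<longlonglongrightarrow> 0"
proof (rule tendsto_sandwich[OF _ _ tendsto_const step_tendsto_0])
  show "eventually (\<lambda>n. max (infdist (x n) A) (infdist (x n) B) \<le> dist (x n) (x (Suc n))) sequentially"
    using max_infdist_le_step by (auto simp: eventually_sequentially)
qed (auto simp: infdist_nonneg le_max_iff_disj)

lemma Delta_convergence: "\<exists>l\<in>A \<inter> B. Delta_converges x l"
proof (rule Fejer_Delta_converges[where F = "A \<inter> B" and x = x, OF AB Fejer])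
  fix k :: "nat \<Rightarrow> nat" and a assume k: "strict_mono k" and a: "a \<in> asymp_center (x \<circ> k)"
  have "(\<lambda>n. infdist ((x \<circ> k) n) C) \<longlonglongrightarrow> 0" if "C = A \<or> C = B" for C
  proof (rule tendsto_sandwich[OF _ _ tendsto_const LIMSEQ_subseq_LIMSEQ[OF max_infdist_tendsto_0 k]])
  qed (use that in \<open>auto simp: infdist_nonneg\<close>)
  then show "a \<in> A \<inter> B"
    using asymp_center_in_convex[OF A _ _ a] asymp_center_in_convex[OF B _ _ a] AB by auto
qed

lemma strong_convergence:
  assumes "(\<lambda>n. infdist (x n) (A \<inter> B)) \<longlonglongrightarrow> 0"
  shows "\<exists>l\<in>A \<inter> B. x \<longlonglongrightarrow> l \<and> (\<forall>n. dist (x n) l \<le> 2 * infdist (x n) (A \<inter> B))"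
  using Fejer_converges[OF convex_Int closed_AB AB Fejer assms] .

lemma infdist_Int_tendsto_0:
  assumes "boundedly_regular A B"
  shows "(\<lambda>n. infdist (x n) (A \<inter> B)) \<longlonglongrightarrow> 0"
proof (rule LIMSEQ_I)
  fix r :: real assume "0 < r"
  then have h: "0 < r / 2" by simp
  from assms h bounded_space obtain \<delta> where \<delta>: "0 < \<delta>"
    "\<And>y. max (infdist y A) (infdist y B) \<le> \<delta> \<Longrightarrow> infdist y (A \<inter> B) \<le> r / 2"
    unfolding boundedly_regular_def by (metis UNIV_I)
  obtain N where "\<forall>n\<ge>N. max (infdist (x n) A) (infdist (x n) B) < \<delta>"
    using order_tendstoD(2)[OF max_infdist_tendsto_0 \<delta>(1)] by (auto simp: eventually_sequentially)
  then have "\<forall>n\<ge>N. infdist (x n) (A \<inter> B) \<le> r / 2" using \<delta>(2) less_imp_le by blast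
  then show "\<exists>N. \<forall>n\<ge>N. norm (infdist (x n) (A \<inter> B) - 0) < r"
    using h by (auto simp: infdist_nonneg intro!: exI[of _ N])
qed

lemma linearly_regular_imp_regular:
  assumes "boundedly_linearly_regular A B"
  shows "boundedly_regular A B"
  unfolding boundedly_regular_def
proof (intro allI impI)
  fix S :: "'a set" and \<epsilon> :: real assume "bounded S" "0 < \<epsilon>"
  then obtain k where k: "0 < k" "\<forall>x\<in>S. infdist x (A \<inter> B) \<le> k * max (infdist x A) (infdist x B)"
    using assms unfolding boundedly_linearly_regular_def by blast
  have "infdist x (A \<inter> B) \<le> \<epsilon>" if "x \<in> S" "max (infdist x A) (infdist x B) \<le> \<epsilon> / k" for x
  proof -
    have "k * max (infdist x A) (infdist x B) \<le> k * (\<epsilon> / k)"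
      using that(2) k(1) by (intro mult_left_mono) auto
    then show ?thesis using k that(1) by fastforce
  qed
  then show "\<exists>\<delta>>0. \<forall>x\<in>S. max (infdist x A) (infdist x B) \<le> \<delta> \<longrightarrow> infdist x (A \<inter> B) \<le> \<epsilon>"
    using k(1) \<open>0 < \<epsilon>\<close> by (intro exI[of _ "\<epsilon> / k"]) auto
qed

text \<open>With \<open>a\<close> and \<open>b\<close> the rescaled distances of \<open>x n\<close> and \<open>x (Suc n)\<close> from \<open>A \<inter> B\<close> and \<open>e\<close> the step, the
  Pythagorean inequality for the projection of \<open>x n\<close> to \<open>A \<inter> B\<close> gives \<open>1 / cos b \<le> cos e / cos a\<close>. Linear
  regularity says \<open>a \<le> N e\<close>, hence \<open>1 - cos a \<le> N\<^sup>2 (1 - cos e)\<close>: the step removes a fixed fraction of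
  \<open>1 / cos a - 1\<close>. Here \<open>x n\<close> must lie in \<open>A \<union> B\<close>, whence \<open>n \<ge> 1\<close>.\<close>

lemma linear_rate:
  assumes N: "0 < N" and k: "\<And>y. infdist y (A \<inter> B) \<le> real N * max (infdist y A) (infdist y B)"
    and d: "\<And>n. d n = c * infdist (x n) (A \<inter> B)"
    and q: "q = 1 - 1 / (real N)\<^sup>2" and n: "1 \<le> n"
  shows "1 / cos (d (Suc n)) - 1 \<le> q * (1 / cos (d n) - 1)"
proof -
  let ?p = "metric_projection (A \<inter> B) (x n)" and ?e = "D (x n) (x (Suc n))"
  have p: "?p \<in> A \<inter> B" "D (x n) ?p = d n"
    using metric_projection[OF convex_Int closed_AB AB, of "x n"] by (auto simp: D_eq d)
  have "d (Suc n) \<le> D (x (Suc n)) ?p"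
    using p(1) c_pos by (simp add: D_eq d infdist_le)
  have d0: "0 \<le> d m" for m using c_pos by (simp add: d infdist_nonneg)
  have b: "cos (D (x (Suc n)) ?p) \<le> cos (d (Suc n))"
    using \<open>d (Suc n) \<le> D (x (Suc n)) ?p\<close> d0 D_less_pi by (intro cos_monotone_0_pi_le) (auto intro: less_imp_le)
  have cd: "0 < cos (d n)" using cos_D_pos[of "x n" ?p] p(2) by simp
  have cd': "0 < cos (d (Suc n))" using b cos_D_pos[of "x (Suc n)" ?p] by linarith
  have "cos (d n) \<le> cos ?e * cos (D (x (Suc n)) ?p)" using step_cosine[OF p(1), of n] p(2) by simp
  also have "\<dots> \<le> cos ?e * cos (d (Suc n))"
    using b cos_D_pos by (intro mult_left_mono) (auto intro: less_imp_le)
  finally have 1: "1 / cos (d (Suc n)) \<le> cos ?e / cos (d n)"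
    using cd cd' by (simp add: field_simps)
  have "d n \<le> c * (real N * dist (x n) (x (Suc n)))"
    unfolding d using k[of "x n"] max_infdist_le_step[OF n] c_pos
    by (intro mult_left_mono) (auto intro: order_trans[OF _ mult_left_mono])
  then have "d n / real N \<le> ?e" using N by (simp add: D_eq field_simps)
  then have "cos ?e \<le> cos (d n / real N)"
    using d0 D_less_pi by (intro cos_monotone_0_pi_le) (auto intro: less_imp_le)
  have "1 - cos (d n) \<le> (real N)\<^sup>2 * (1 - cos (d n / real N))"
    using one_minus_cos_multiple[of N "d n / real N"] N by simp
  also have "\<dots> \<le> (real N)\<^sup>2 * (1 - cos ?e)"
    using \<open>cos ?e \<le> cos (d n / real N)\<close> by (intro mult_left_mono) auto
  finally have "(1 - cos (d n)) / (real N)\<^sup>2 \<le> 1 - cos ?e"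
    using N by (simp add: field_simps)
  then have "cos ?e - cos (d n) \<le> q * (1 - cos (d n))"
    by (simp add: q left_diff_distrib)
  then have "(cos ?e - cos (d n)) / cos (d n) \<le> q * (1 - cos (d n)) / cos (d n)"
    using cd by (intro divide_right_mono) auto
  then show ?thesis using 1 cd by (simp add: diff_divide_distrib right_diff_distrib)
qed

lemma linear_convergence:
  assumes lin: "boundedly_linearly_regular A B"
  shows "\<exists>l\<in>A \<inter> B. converges_linearly x l"
proof -
  obtain k where k: "0 < k" "\<And>y. infdist y (A \<inter> B) \<le> k * max (infdist y A) (infdist y B)"
    using lin bounded_space unfolding boundedly_linearly_regular_def by (metis UNIV_I)
  \<comment> \<open>The bound \<open>2 < N\<close> makes the rate \<open>q\<close> positive; this is needed to absorb the shift by the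
    first step into the constant.\<close>
  obtain N :: nat where N: "max 2 k < real N" using reals_Archimedean2 by blast
  have kN: "infdist y (A \<inter> B) \<le> real N * max (infdist y A) (infdist y B)" for y
    using N by (intro order_trans[OF k(2)] mult_right_mono) (auto simp: le_max_iff_disj infdist_nonneg)
  have N0: "0 < N" using N by simp
  define q where "q = 1 - 1 / (real N)\<^sup>2"
  have "1 < (real N)\<^sup>2" using N by (intro one_less_power) auto
  then have q: "0 < q" "q < 1" using N0 by (auto simp: q_def field_simps)
  define d where "d n = c * infdist (x n) (A \<inter> B)" for n
  define \<psi> where "\<psi> n = 1 / cos (d n) - 1" for n
  have dR: "0 \<le> d n" "d n \<le> R" for n
  proof -
    show "0 \<le> d n" using c_pos by (simp add: d_def infdist_nonneg)
    obtain y where "y \<in> A \<inter> B" using AB by blast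
    then have "d n \<le> D (x n) y" using c_pos by (simp add: d_def D_eq infdist_le)
    then show "d n \<le> R" using D_le order_trans by blast
  qed
  have \<psi>: "\<psi> (Suc n) \<le> q ^ n * \<psi> 1" for n
  proof (induction n)
    case (Suc n)
    have "\<psi> (Suc (Suc n)) \<le> q * \<psi> (Suc n)"
      unfolding \<psi>_def by (rule linear_rate[OF N0 kN d_def q_def]) simp
    also have "\<dots> \<le> q * (q ^ n * \<psi> 1)" using Suc q by simp
    finally show ?case by simp
  qed simp
  have cR: "0 < cos R" using R_nonneg R_less by (intro cos_gt_zero_pi) auto
  \<comment> \<open>The quantity that decays like \<open>q ^ n\<close> is comparable to the square of the distance.\<close>
  define \<alpha> where "\<alpha> = sqrt q"
  define K where "K = sqrt (2 * \<psi> 1) / cos R"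
  have \<alpha>: "0 < \<alpha>" "\<alpha> < 1" using q by (auto simp: \<alpha>_def)
  have dK: "d (Suc n) \<le> K * \<alpha> ^ n" for n
  proof -
    have "(d (Suc n) * cos R)\<^sup>2 \<le> 2 * \<psi> (Suc n)"
      unfolding \<psi>_def using dR R_less by (intro square_le_sec_minus_one)
    also have "\<dots> \<le> 2 * \<psi> 1 * q ^ n" using \<psi>[of n] by (simp add: ac_simps)
    finally have "d (Suc n) * cos R \<le> sqrt (2 * \<psi> 1 * q ^ n)"
      by (rule real_le_rsqrt)
    then have "d (Suc n) * cos R \<le> sqrt (2 * \<psi> 1) * \<alpha> ^ n"
      by (simp add: \<alpha>_def real_sqrt_mult real_sqrt_power)
    then show ?thesis using cR by (simp add: K_def field_simps)
  qed
  obtain l where l: "l \<in> A \<inter> B" "\<And>n. dist (x n) l \<le> 2 * infdist (x n) (A \<inter> B)"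
    using strong_convergence[OF infdist_Int_tendsto_0[OF linearly_regular_imp_regular[OF lin]]] by blast
  define K' where "K' = max (dist (x 0) l) (2 * K / (c * \<alpha>))"
  have "dist (x n) l \<le> K' * \<alpha> ^ n" for n
  proof (cases n)
    case (Suc m)
    have "dist (x n) l \<le> 2 * (d n / c)" using l(2)[of n] c_pos by (simp add: d_def)
    also have "\<dots> \<le> 2 * (K * \<alpha> ^ m / c)"
      using dK[of m] c_pos by (simp add: Suc divide_right_mono)
    also have "\<dots> = 2 * K / (c * \<alpha>) * \<alpha> ^ n" using \<alpha> by (simp add: Suc)
    also have "\<dots> \<le> K' * \<alpha> ^ n" using \<alpha> by (intro mult_right_mono) (auto simp: K'_def)
    finally show ?thesis .
  qed (simp add: K'_def)
  moreover have "0 \<le> K'" by (simp add: K'_def le_max_iff_disj)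
  ultimately show ?thesis
    using l(1) \<alpha> unfolding converges_linearly_def by (auto intro!: bexI[of _ l] exI[of _ K'] bexI[of _ \<alpha>])
qed

end

theorem theorem3p7:
  fixes \<kappa> :: real
    and A B :: "'a::complete_space set"
    and x :: "nat \<Rightarrow> 'a"
  assumes "\<kappa> > 0"
    and "CAT \<kappa> TYPE('a)"
    and "bounded (UNIV :: 'a set)"
    and "diameter (UNIV :: 'a set) < D_bound \<kappa> / 2"
    and "A \<noteq> {}" and "closed A" and "geodesically_convex A"
    and "B \<noteq> {}" and "closed B" and "geodesically_convex B"
    and "A \<inter> B \<noteq> {}"
    and "\<And>n. n \<ge> 1 \<Longrightarrow> x (2 * n - 1) = metric_projection A (x (2 * n - 2))"
    and "\<And>n. n \<ge> 1 \<Longrightarrow> x (2 * n) = metric_projection B (x (2 * n - 1))"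
  shows "(\<exists>l \<in> A \<inter> B. Delta_converges x l)
    \<and> (boundedly_regular A B \<longrightarrow> (\<exists>l \<in> A \<inter> B. x \<longlonglongrightarrow> l))
    \<and> (boundedly_linearly_regular A B \<longrightarrow> (\<exists>l \<in> A \<inter> B. converges_linearly x l))"
proof -
  define R where "R = sqrt \<kappa> * diameter (UNIV :: 'a set)"
  have c: "0 < sqrt \<kappa>" using assms(1) by simp
  have R: "R < pi / 2" using assms(4) c by (simp add: R_def D_bound_def field_simps)
  have le: "sqrt \<kappa> * dist u v \<le> R" for u v :: 'a
    unfolding R_def using c diameter_bounded_bound[OF assms(3)] by (intro mult_left_mono) auto
  have ex: "\<exists>\<gamma>. geodesic \<gamma> u v" for u v :: 'a
  proof -
    have "sqrt \<kappa> * dist u v < pi" using le[of u v] R pi_gt_zero by linarith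
    then have "dist u v < D_bound \<kappa>" using c by (simp add: D_bound_def field_simps)
    then show ?thesis using assms(2) unfolding CAT_def by blast
  qed
  interpret alternating_projections "sqrt \<kappa>" R "\<lambda>u v :: 'a. sqrt \<kappa> * dist u v" A B x
  proof
    show "x (Suc n) = metric_projection (if even n then A else B) (x n)" for n
    proof (cases "even n")
      case True
      then obtain m where "n = 2 * m" by blast
      then show ?thesis using assms(12)[of "Suc m"] by simp
    next
      case False
      then obtain m where "n = 2 * m + 1" by (rule oddE)
      then show ?thesis using assms(13)[of "Suc m"] by simp
    qed
  qed (use assms c R le ex in \<open>auto intro!: CAT_cosine_inequality le_less_trans[OF le R]\<close>)
  show ?thesis
    using Delta_convergence strong_convergence[OF infdist_Int_tendsto_0] linear_convergence by blast
qed

end
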